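(* Let $k\in\mathbb{N}\cup\{0\}$ and let $h\in C_c^\infty((0,2))$ satisfy the evenness condition $$[\mathcal{L}_kh](1-t)=[\mathcal{L}_kh](1+t)\qquad\text{for all }t\in[0,1].$$ Then for any $\lambda>0$ the following identity holds: $$\left(\int_0^\infty j_{k+\frac12}(\lambda t)\,t\,h(t)\,\mathrm dt\right)y_{k+\frac12}(\lambda)=\left(\int_0^\infty y_{k+\frac12}(\lambda t)\,t\,h(t)\,\mathrm dt\right)j_{k+\frac12}(\lambda).$$
   Context: Functions in $C_c^\infty((0,2))$ are extended by zero. The operator $\mathcal{L}_k$ is $$\mathcal{L}_k=\sum_{l=0}^{k}\frac{(k+l)!}{(k-l)!\,l!\,2^l}\,(1-t)^{k-l}D^{k-l},\qquad D=\frac1t\frac{\mathrm d}{\mathrm dt},$$ with $D^j$ the $j$-fold iterate of $D$, and $[\mathcal{L}_kh](\cdot)$ denotes evaluation of the function $\mathcal{L}_kh$ at the given point (it is $0$ at $0$ and $2$). The normalized (spherical) Bessel functions of the first and second kind, in the paper's (non-standard) normalization, are, for $2\alpha\in\{1,3,5,\dots\}$ and $x>0$, $$j_\alpha(x)=-\frac{(-2)^{\alpha+1/2}\Gamma(\alpha+1)}{\sqrt\pi}\left(\frac1x\frac{\mathrm d}{\mathrm dx}\right)^{\alpha-1/2}\left(\frac{\sin x}{x}\right)=\Gamma(\alpha+1)\sum_{i=0}^\infty\frac{(-1)^i(x/2)^{2i}}{i!\,\Gamma(i+\alpha+1)},$$ $$y_\alpha(x)=-\frac{(-2)^{\alpha+1/2}\Gamma(\alpha+1)}{\sqrt\pi}\left(\frac1x\frac{\mathrm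 d}{\mathrm dx}\right)^{\alpha-1/2}\left(\frac{\cos x}{x}\right).$$ *)

theory Defs
  imports "HOL-Analysis.Analysis"
begin

text \<open>
  \<open>C_c^\<infinity>(S)\<close> for open \<open>S \<subseteq> \<real>\<close>; members are total functions on \<open>\<real>\<close>, the support condition
  making them vanish outside \<open>S\<close> (extension by zero). The type \<open>'a\<close> is the scalar field,
  \<open>real\<close> or \<open>complex\<close>.
\<close>

definition Cc_infinity :: "real set \<Rightarrow> (real \<Rightarrow> 'a::{real_normed_field,banach}) set" where
  "Cc_infinity S = {h.
     (\<forall>n. \<forall>t\<in>S. ((\<lambda>g s. vector_derivative g (at s)) ^^ n) h differentiable (at t)) \<and>
     compact (closure {t. h t \<noteq> 0}) \<and> closure {t. h t \<noteq> 0} \<subseteq> S}"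

definition D_op :: "(real \<Rightarrow> 'a) \<Rightarrow> real \<Rightarrow> 'a::{real_normed_field,banach}" where
  "D_op f t = 1 / of_real t * vector_derivative f (at t)"

text \<open>
  At \<open>t = 0\<close> division by zero gives \<open>D_op f 0 = 0\<close>, so \<open>L_op k h 0 = 0\<close> whenever \<open>h 0 = 0\<close>.
\<close>

definition L_op :: "nat \<Rightarrow> (real \<Rightarrow> 'a) \<Rightarrow> real \<Rightarrow> 'a::{real_normed_field,banach}" where
  "L_op k h t = (\<Sum>l=0..k. of_real (fact (k + l) / (fact (k - l) * fact l * 2 ^ l)
                    * (1 - t) ^ (k - l)) * (D_op ^^ (k - l)) h t)"

text \<open>
  The normalized spherical Bessel functions \<open>j\<^sub>\<alpha>\<close> and \<open>y\<^sub>\<alpha>\<close> of order \<open>\<alpha> = n + 1/2\<close>, indexed by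
  \<open>n = \<alpha> - 1/2\<close>, so that \<open>\<alpha> + 1/2 = n + 1\<close> and \<open>\<alpha> + 1 = n + 3/2\<close>. They are meaningful for
  \<open>x > 0\<close> only: at \<open>x = 0\<close> the first one does not take the value 1 of its analytic extension.
\<close>

definition bessel_j :: "nat \<Rightarrow> real \<Rightarrow> real" where
  "bessel_j n x = - ((-2) ^ (n + 1) * Gamma (real n + 3/2) / sqrt pi)
                    * (D_op ^^ n) (\<lambda>x. sin x / x) x"

definition bessel_y :: "nat \<Rightarrow> real \<Rightarrow> real" where
  "bessel_y n x = - ((-2) ^ (n + 1) * Gamma (real n + 3/2) / sqrt pi)
                    * (D_op ^^ n) (\<lambda>x. cos x / x) x"

end

theory Submission
  imports Defs
begin

text \<open>
  Put \<open>D = (1/t) d/dt\<close>, \<open>s = t - 1\<close>, \<open>D\<^sub>s = (1/s) d/ds\<close> and \<open>g = D\<^sup>k h\<close>. Up to a common constant,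
  \<open>j\<^sub>k(\<lambda>t)\<close> and \<open>y\<^sub>k(\<lambda>t)\<close> are \<open>D\<^sup>k\<close> applied to \<open>sin(\<lambda>t)/t\<close> and \<open>cos(\<lambda>t)/t\<close>, and integration by parts
  moves \<open>D\<^sup>k\<close> onto \<open>h\<close> with respect to the measure \<open>t dt\<close> (\<open>integral_bessel_parts\<close>). With
  \<open>p\<^sub>k\<close> and \<open>q\<^sub>k\<close> denoting \<open>\<lambda>\<^bsup>2k+1\<^esup>\<close> times the values of \<open>((1/x) d/dx)\<^sup>k\<close> of \<open>cos x / x\<close> and \<open>sin x / x\<close> at
  \<open>x = \<lambda>\<close>, the claim is that \<open>\<integral> (p\<^sub>k sin(\<lambda>t) - q\<^sub>k cos(\<lambda>t)) g(t) dt = 0\<close>.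
  
  Both \<open>p\<^sub>k\<close> and \<open>q\<^sub>k\<close> satisfy \<open>x\<^sub>k\<^sub>+\<^sub>2 = -(2k+3) x\<^sub>k\<^sub>+\<^sub>1 - \<lambda>\<^sup>2 x\<^sub>k\<close>. On the other side, let \<open>M\<^sub>k\<close> be the
  binomial difference \<open>\<Sum>\<^sub>i (-1)\<^sup>i (k choose i) \<L>\<^sub>k\<^sub>-\<^sub>i D\<^sup>i\<close>. It satisfies
  \<open>M\<^sub>k\<^sub>+\<^sub>2 = (2k+3) M\<^sub>k\<^sub>+\<^sub>1 + (d/dt)\<^sup>2 M\<^sub>k\<close> (\<open>L_diff_second_derivative\<close>). Under the integral against
  \<open>sin(\<lambda>s)\<close> the second derivative becomes \<open>-\<lambda>\<^sup>2\<close>, so \<open>(-1)\<^sup>k \<integral> sin(\<lambda>s) M\<^sub>k g dt\<close> obeys the same recurrence as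
  the integral above. The two agree for \<open>k = 0, 1\<close>, hence always, for any iterate \<open>g = D\<^sup>m h\<close> (\<open>bessel_pairing\<close>).
  
  Finally \<open>M\<^sub>k D\<^sup>k h = D\<^sub>s\<^sup>k \<L>\<^sub>k h\<close>, because \<open>D\<^sub>s \<L>\<^sub>k = \<L>\<^sub>k D - \<L>\<^sub>k\<^sub>-\<^sub>1 D\<^sup>2\<close> for \<open>k \<ge> 1\<close> (\<open>L_seq_deriv\<close>, \<open>L_diff_deriv\<close>).
  Since \<open>D\<^sub>s\<close> preserves evenness about \<open>t = 1\<close>, the hypothesis makes \<open>M\<^sub>k g\<close> even there, whereas
  \<open>sin(\<lambda>s)\<close> is odd, and the integral vanishes.
\<close>

section \<open>The operators along a chain of radial derivatives\<close>

text \<open>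
  A chain consists of the iterates \<open>H m = D\<^sup>m h\<close> of a function \<open>h\<close>. Writing \<open>D f = g\<close> as
  \<open>f' = t g\<close> keeps the relation meaningful at \<open>t = 0\<close>.
\<close>
definition radial_chain :: "(nat \<Rightarrow> real \<Rightarrow> 'a::real_normed_field) \<Rightarrow> bool" where
  "radial_chain H \<longleftrightarrow> (\<forall>m t. (H m has_vector_derivative t *\<^sub>R H (Suc m) t) (at t))"

text \<open>
  \<open>L_seq H k m\<close> stands for \<open>\<L>\<^sub>k D\<^sup>m h\<close>. The recurrence is that of the reverse Bessel polynomials
  \<open>\<theta>\<^sub>k\<^sub>+\<^sub>2(x) = (2k+3) \<theta>\<^sub>k\<^sub>+\<^sub>1(x) + x\<^sup>2 \<theta>\<^sub>k(x)\<close>: formally, \<open>\<L>\<^sub>k = \<theta>\<^sub>k((1 - t) D)\<close> with all factors \<open>1 - t\<close> to the left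
  of all \<open>D\<close>.
\<close>
fun L_seq :: "(nat \<Rightarrow> real \<Rightarrow> 'a::real_normed_field) \<Rightarrow> nat \<Rightarrow> nat \<Rightarrow> real \<Rightarrow> 'a" where
  "L_seq H 0 m t = H m t"
| "L_seq H (Suc 0) m t = H m t - (t - 1) *\<^sub>R H (Suc m) t"
| "L_seq H (Suc (Suc k)) m t =
     (2 * real k + 3) *\<^sub>R L_seq H (Suc k) m t + (t - 1)\<^sup>2 *\<^sub>R L_seq H k (Suc (Suc m)) t"

text \<open>
  The coefficient of \<open>x\<^bsup>k-l\<^esup>\<close> in the reverse Bessel polynomial \<open>\<theta>\<^sub>k(x)\<close>; the zero values for \<open>l > k\<close> let the
  recurrence hold for all indices.
\<close>
definition bessel_coeff :: "nat \<Rightarrow> nat \<Rightarrow> real" where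
  "bessel_coeff k l = (if l \<le> k then fact (k + l) / (fact (k - l) * fact l * 2 ^ l) else 0)"

text \<open>
  Once a common factorial is divided out, the generic case \<open>k = l + 1 + p\<close> reduces to
  \<open>(2l+p+4)(2l+p+3) = 2(2l+2p+5)(l+1) + (p+2)(p+1)\<close>; on the boundary \<open>l \<in> {k, k+1}\<close> the
  second coefficient on the right vanishes.
\<close>
lemma bessel_coeff_Suc:
  "bessel_coeff (Suc (Suc k)) (Suc l) = (2 * real k + 3) * bessel_coeff (Suc k) l + bessel_coeff k (Suc l)"
proof -
  consider "l \<ge> Suc (Suc k)" | "l = Suc k" | "l = k" | p where "k = Suc l + p"
    by (metis le_add_diff_inverse linorder_not_less less_SucE not_less_eq_eq)
  then show ?thesis
  proof cases
    case 1
    then show ?thesis by (simp add: bessel_coeff_def)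
  next
    case 2
    define A Q :: real where "A = fact (2 * k + 2)" and "Q = fact (Suc k)"
    have "A \<noteq> 0" "Q \<noteq> 0" by (simp_all add: A_def Q_def)
    have "Suc (Suc k) + Suc l = Suc (Suc (2 * k + 2))" "Suc k + l = 2 * k + 2" using 2 by auto
    then have num: "fact (Suc (Suc k) + Suc l) = (2 * real k + 4) * ((2 * real k + 3) * A)" "fact (Suc k + l) = A"
      unfolding A_def by (simp_all only: fact_Suc) (simp_all add: algebra_simps)
    have den: "fact (Suc l) = (real k + 2) * Q" "fact l = Q" "Suc (Suc k) - Suc l = 0" "Suc k - l = 0"
      unfolding 2 Q_def fact_Suc[of "Suc k"] by (simp_all del: fact_Suc)
    have if_eq: "Suc l \<le> Suc (Suc k)" "l \<le> Suc k" "\<not> Suc l \<le> k" using 2 by auto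
    have nz: "real k + 2 \<noteq> 0" by linarith
    show ?thesis
      unfolding bessel_coeff_def if_P[OF if_eq(1)] if_P[OF if_eq(2)] if_not_P[OF if_eq(3)] num den
      using \<open>A \<noteq> 0\<close> \<open>Q \<noteq> 0\<close> nz by (simp add: divide_simps)
  next
    case 3
    define A Q :: real where "A = fact (2 * k + 1)" and "Q = fact k"
    have "A \<noteq> 0" "Q \<noteq> 0" by (simp_all add: A_def Q_def)
    have "Suc (Suc k) + Suc l = Suc (Suc (2 * k + 1))" "Suc k + l = 2 * k + 1" using 3 by auto
    then have num: "fact (Suc (Suc k) + Suc l) = (2 * real k + 3) * ((2 * real k + 2) * A)" "fact (Suc k + l) = A"
      unfolding A_def by (simp_all only: fact_Suc) (simp_all add: algebra_simps)
    have den: "fact (Suc l) = (real k + 1) * Q" "fact l = Q" "Suc (Suc k) - Suc l = 1" "Suc k - l = 1"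
      unfolding 3 Q_def by simp_all
    have if_eq: "Suc l \<le> Suc (Suc k)" "l \<le> Suc k" "\<not> Suc l \<le> k" using 3 by auto
    have nz: "real k + 1 \<noteq> 0" by linarith
    show ?thesis
      unfolding bessel_coeff_def if_P[OF if_eq(1)] if_P[OF if_eq(2)] if_not_P[OF if_eq(3)] num den
      using \<open>A \<noteq> 0\<close> \<open>Q \<noteq> 0\<close> nz by (simp add: divide_simps)
  next
    case 4
    define A Q P :: real where "A = fact (2 * l + p + 2)" and "Q = fact l" and "P = fact p"
    have "A \<noteq> 0" "Q \<noteq> 0" "P \<noteq> 0" by (simp_all add: A_def P_def Q_def)
    have "Suc (Suc k) + Suc l = Suc (Suc (2 * l + p + 2))" "Suc k + l = 2 * l + p + 2" "k + Suc l = 2 * l + p + 2"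
      using 4 by auto
    then have num: "fact (Suc (Suc k) + Suc l) = (2 * real l + real p + 4) * ((2 * real l + real p + 3) * A)"
        "fact (Suc k + l) = A" "fact (k + Suc l) = A"
      unfolding A_def by (simp_all only: fact_Suc) (simp_all add: algebra_simps)
    have "Suc (Suc k) - Suc l = Suc (Suc p)" "Suc k - l = Suc (Suc p)" "k - Suc l = p"
      using 4 by auto
    then have den: "fact (Suc (Suc k) - Suc l) = (real p + 2) * ((real p + 1) * P)"
        "fact (Suc k - l) = (real p + 2) * ((real p + 1) * P)" "fact (k - Suc l) = P"
      unfolding P_def by (simp_all add: algebra_simps)
    have "fact (Suc l) = (real l + 1) * Q" by (simp add: Q_def)
    note F = num den this Q_def[symmetric]
    have le: "Suc l \<le> Suc (Suc k)" "l \<le> Suc k" "Suc l \<le> k" using 4 by auto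
    have nz: "real p + 2 \<noteq> 0" "real p + 1 \<noteq> 0" "real l + 1 \<noteq> 0" by linarith+
    have k: "real k = real l + real p + 1" using 4 by simp
    show ?thesis
      unfolding bessel_coeff_def if_P[OF le(1)] if_P[OF le(2)] if_P[OF le(3)] F k
      using \<open>A \<noteq> 0\<close> \<open>Q \<noteq> 0\<close> \<open>P \<noteq> 0\<close> nz
      by (simp add: divide_simps) (simp add: algebra_simps)
  qed
qed

lemma L_seq_closed_form:
  "L_seq H k m t = (\<Sum>l=0..k. (bessel_coeff k l * (1 - t) ^ (k - l)) *\<^sub>R H (m + (k - l)) t)"
proof (induction k arbitrary: m rule: induct_nat_012)
  case 0
  show ?case by (simp add: bessel_coeff_def)
next
  case 1
  show ?case by (simp add: bessel_coeff_def algebra_simps)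
next
  case (ge2 k)
  \<comment> \<open>All sums are brought to the powers of degree \<open>k + 2\<close>, in which the coefficient recurrence can be
    applied termwise; the leading term \<open>l = 0\<close> has coefficient 1 in every row.\<close>
  define g where "g c l = (c * (1 - t) ^ (k + 2 - l)) *\<^sub>R H (m + (k + 2 - l)) t" for c l
  have g_add: "g (c + d) l = g c l + g d l" for c d l
    by (simp add: g_def algebra_simps)
  have "(\<Sum>l=0..k+2. g (bessel_coeff (k+2) l) l)
      = g 1 0 + (\<Sum>l=0..Suc k. g (bessel_coeff (k+2) (Suc l)) (Suc l))"
    by (simp add: sum.atLeast0_atMost_Suc_shift bessel_coeff_def del: sum.cl_ivl_Suc)
  also have "\<dots> = (\<Sum>l=0..Suc k. g ((2 * real k + 3) * bessel_coeff (Suc k) l) (Suc l))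
      + (g 1 0 + (\<Sum>l=0..Suc k. g (bessel_coeff k (Suc l)) (Suc l)))"
    by (simp add: bessel_coeff_Suc g_add sum.distrib del: sum.cl_ivl_Suc)
  also have "g 1 0 + (\<Sum>l=0..Suc k. g (bessel_coeff k (Suc l)) (Suc l)) = (\<Sum>l=0..Suc (Suc k). g (bessel_coeff k l) l)"
    by (simp only: sum.atLeast0_atMost_Suc_shift o_def) (simp add: bessel_coeff_def)
  also have "\<dots> = (\<Sum>l=0..k. g (bessel_coeff k l) l)"
    by (simp add: bessel_coeff_def g_def)
  also have "\<dots> = (t - 1)\<^sup>2 *\<^sub>R L_seq H k (Suc (Suc m)) t"
    unfolding ge2.IH scaleR_sum_right
  proof (intro sum.cong refl)
    fix l assume "l \<in> {0..k}"
    then have "k + 2 - l = Suc (Suc (k - l))" by auto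
    then show "g (bessel_coeff k l) l =
        (t - 1)\<^sup>2 *\<^sub>R (bessel_coeff k l * (1 - t) ^ (k - l)) *\<^sub>R H (Suc (Suc m) + (k - l)) t"
      by (simp add: g_def power2_eq_square algebra_simps)
  qed
  also have "(\<Sum>l=0..Suc k. g ((2 * real k + 3) * bessel_coeff (Suc k) l) (Suc l)) = (2 * real k + 3) *\<^sub>R L_seq H (Suc k) m t"
    unfolding ge2.IH scaleR_sum_right by (intro sum.cong refl) (simp add: g_def mult.assoc)
  finally show ?case
    by (simp add: g_def del: sum.cl_ivl_Suc)
qed

lemma L_op_eq_L_seq: "L_op k h t = L_seq (\<lambda>m. (D_op ^^ m) h) k 0 t"
  unfolding L_op_def L_seq_closed_form
  by (intro sum.cong refl) (simp add: bessel_coeff_def scaleR_conv_of_real)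

text \<open>
  This is \<open>D\<^sub>s \<L>\<^sub>k\<^sub>+\<^sub>1 = \<L>\<^sub>k\<^sub>+\<^sub>1 D - \<L>\<^sub>k D\<^sup>2\<close>, freed of the division by \<open>s = t - 1\<close>. It reflects the
  identity \<open>\<theta>\<^sub>k\<^sub>+\<^sub>1' = \<theta>\<^sub>k\<^sub>+\<^sub>1 - x \<theta>\<^sub>k\<close> and follows by differentiating the three-term recurrence.
\<close>
lemma L_seq_deriv:
  assumes "radial_chain H"
  shows "(L_seq H (Suc k) m has_vector_derivative
           (t - 1) *\<^sub>R (L_seq H (Suc k) (Suc m) t - L_seq H k (Suc (Suc m)) t)) (at t)"
proof (induction k arbitrary: m rule: induct_nat_012)
  case 0
  have H: "\<And>m. (H m has_vector_derivative t *\<^sub>R H (Suc m) t) (at t)"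
    using assms by (simp add: radial_chain_def)
  have [simp]: "L_seq H (Suc 0) m = (\<lambda>t. H m t - (t - 1) *\<^sub>R H (Suc m) t)" by (rule ext) simp
  show ?case
    by (auto intro!: derivative_eq_intros H) (simp add: scaleR_conv_of_real algebra_simps)
next
  case 1
  have H: "\<And>m. (H m has_vector_derivative t *\<^sub>R H (Suc m) t) (at t)"
    using assms by (simp add: radial_chain_def)
  have [simp]: "L_seq H (Suc (Suc 0)) m =
      (\<lambda>t. 3 *\<^sub>R (H m t - (t - 1) *\<^sub>R H (Suc m) t) + (t - 1)\<^sup>2 *\<^sub>R H (Suc (Suc m)) t)"
    by (rule ext) simp
  show ?case
    by (auto intro!: derivative_eq_intros H) (simp add: scaleR_conv_of_real algebra_simps power2_eq_square)
next
  case (ge2 k)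
  have [simp]: "L_seq H (Suc (Suc (Suc k))) m =
      (\<lambda>t. (2 * real (Suc k) + 3) *\<^sub>R L_seq H (Suc (Suc k)) m t + (t - 1)\<^sup>2 *\<^sub>R L_seq H (Suc k) (Suc (Suc m)) t)"
    by (rule ext) simp
  have S: "(t - 1) *\<^sub>R (L_seq H (Suc (Suc (Suc k))) (Suc m) t - L_seq H (Suc (Suc k)) (Suc (Suc m)) t) =
     (2 * real (Suc k) + 3) *\<^sub>R ((t - 1) *\<^sub>R (L_seq H (Suc (Suc k)) (Suc m) t - L_seq H (Suc k) (Suc (Suc m)) t))
     + ((t - 1)\<^sup>2 *\<^sub>R ((t - 1) *\<^sub>R (L_seq H (Suc k) (Suc (Suc (Suc m))) t - L_seq H k (Suc (Suc (Suc (Suc m)))) t))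
       + (2 * (t - 1)) *\<^sub>R L_seq H (Suc k) (Suc (Suc m)) t)"
    by (simp add: scaleR_conv_of_real algebra_simps power2_eq_square)
  show ?case
    unfolding S
    by (auto intro!: derivative_eq_intros ge2.IH(1) ge2.IH(2) simp del: L_seq.simps)
qed

section \<open>Differences of the operators\<close>

text \<open>
  The \<open>j\<close>-fold difference \<open>\<Sum>\<^sub>i (-1)\<^sup>i (j choose i) \<L>\<^sub>d\<^sub>+\<^sub>j\<^sub>-\<^sub>i D\<^bsup>m+i\<^esup> h\<close>. Indexing by \<open>d\<close>, the excess of the order of
  \<open>\<L>\<close> over \<open>j\<close>, makes the recursive step total. The case \<open>d = 0\<close>, \<open>j = k\<close> is \<open>M\<^sub>k D\<^sup>m h\<close>.
\<close>
fun L_diff :: "(nat \<Rightarrow> real \<Rightarrow> 'a::real_normed_field) \<Rightarrow> nat \<Rightarrow> nat \<Rightarrow> nat \<Rightarrow> real \<Rightarrow> 'a" where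
  "L_diff H 0 d m t = L_seq H d m t"
| "L_diff H (Suc j) d m t = L_diff H j (Suc d) m t - L_diff H j d (Suc m) t"

text \<open>
  Iterated, this gives \<open>D\<^sub>s\<^sup>j \<L>\<^sub>k h = L_diff H j (k - j) j\<close> away from \<open>t = 1\<close>. The formula for \<open>j = 0\<close> is
  \<open>L_seq_deriv\<close>, and differences in \<open>j\<close> preserve it.
\<close>
lemma L_diff_deriv:
  assumes "radial_chain H"
  shows "(L_diff H j (Suc d) m has_vector_derivative (t - 1) *\<^sub>R L_diff H (Suc j) d (Suc m) t) (at t)"
proof (induction j arbitrary: d m)
  case 0
  have [simp]: "L_diff H 0 (Suc d) m = L_seq H (Suc d) m" by (rule ext) simp
  show ?case using L_seq_deriv[OF assms, of d m t] by simp
next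
  case (Suc j)
  have F: "L_diff H (Suc j) (Suc d) m = (\<lambda>t. L_diff H j (Suc (Suc d)) m t - L_diff H j (Suc d) (Suc m) t)"
    by (rule ext) simp
  have D: "(t - 1) *\<^sub>R L_diff H (Suc (Suc j)) d (Suc m) t =
      (t - 1) *\<^sub>R L_diff H (Suc j) (Suc d) (Suc m) t - (t - 1) *\<^sub>R L_diff H (Suc j) d (Suc (Suc m)) t"
    by (simp only: L_diff.simps(2)[of H "Suc j"] scaleR_diff_right)
  show ?case
    unfolding F D by (intro has_vector_derivative_diff Suc.IH)
qed

text \<open>
  The second derivative is recorded together with the vanishing of the function and of its first
  derivative where the chain vanishes, which removes the boundary terms in integration by parts.
\<close>
definition second_derivative_on_support ::
    "(nat \<Rightarrow> real \<Rightarrow> 'a::real_normed_field) \<Rightarrow> (real \<Rightarrow> 'a) \<Rightarrow> (real \<Rightarrow> 'a) \<Rightarrow> bool" where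
  "second_derivative_on_support H F F2 \<longleftrightarrow>
     (\<exists>V. (\<forall>t. (F has_vector_derivative V t) (at t)) \<and>
          (\<forall>t. (V has_vector_derivative F2 t) (at t)) \<and>
          (\<forall>t. (\<forall>m. H m t = 0) \<longrightarrow> F t = 0 \<and> V t = 0))"

lemma second_derivative_on_supportI:
  assumes "\<And>t. (F has_vector_derivative V t) (at t)"
    and "\<And>t. (V has_vector_derivative F2 t) (at t)"
    and "\<And>t. (\<forall>m. H m t = 0) \<Longrightarrow> F t = 0"
    and "\<And>t. (\<forall>m. H m t = 0) \<Longrightarrow> V t = 0"
  shows "second_derivative_on_support H F F2"
  using assms unfolding second_derivative_on_support_def by blast

lemma second_derivative_on_support_diff:
  assumes "second_derivative_on_support H F F2" "second_derivative_on_support H G G2"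
  shows "second_derivative_on_support H (\<lambda>t. F t - G t) (\<lambda>t. F2 t - G2 t)"
proof -
  from assms(1) obtain V where V: "\<And>t. (F has_vector_derivative V t) (at t)"
      "\<And>t. (V has_vector_derivative F2 t) (at t)"
      "\<And>t. (\<forall>m. H m t = 0) \<Longrightarrow> F t = 0 \<and> V t = 0"
    unfolding second_derivative_on_support_def by blast
  from assms(2) obtain W where W: "\<And>t. (G has_vector_derivative W t) (at t)"
      "\<And>t. (W has_vector_derivative G2 t) (at t)"
      "\<And>t. (\<forall>m. H m t = 0) \<Longrightarrow> G t = 0 \<and> W t = 0"
    unfolding second_derivative_on_support_def by blast
  show ?thesis
    by (rule second_derivative_on_supportI[where V = "\<lambda>t. V t - W t"])
       (auto intro!: has_vector_derivative_diff V(1,2) W(1,2) simp: V(3) W(3))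
qed

lemma second_derivative_on_support_continuous:
  "second_derivative_on_support H F F2 \<Longrightarrow> continuous_on A F"
  unfolding second_derivative_on_support_def
  by (meson has_vector_derivative_continuous continuous_at_imp_continuous_on)

lemma L_seq_eq_0: "(\<forall>m. H m t = 0) \<Longrightarrow> L_seq H k m t = 0"
  by (induction k arbitrary: m rule: induct_nat_012) auto

lemma L_diff_eq_0: "(\<forall>m. H m t = 0) \<Longrightarrow> L_diff H j d m t = 0"
  by (induction j arbitrary: d m) (auto simp: L_seq_eq_0)

text \<open>
  For \<open>d \<ge> 2\<close> the first-derivative formula applies twice and the three-term recurrence absorbs the
  factor \<open>(t - 1)\<^sup>2\<close>. For \<open>d = 0, 1\<close> that formula cannot be applied twice and the derivatives are computed
  directly. In the case \<open>d = 0\<close> the index \<open>d - 1\<close> truncates to 0, harmlessly, since its coefficient is 0.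
\<close>
lemma L_seq_second_derivative:
  assumes "radial_chain H"
  shows "second_derivative_on_support H (L_seq H d m)
     (\<lambda>t. L_diff H 2 d m t - (2 * real d + 3) *\<^sub>R L_diff H 1 d m t
        + (2 * real d) *\<^sub>R L_diff H 1 (d - 1) (Suc m) t)"
proof -
  have H: "\<And>m t. (H m has_vector_derivative t *\<^sub>R H (Suc m) t) (at t)"
    using assms by (simp add: radial_chain_def)
  have two: "L_diff H 2 d m t = L_seq H (Suc (Suc d)) m t - 2 * L_seq H (Suc d) (Suc m) t + L_seq H d (Suc (Suc m)) t" for d m t
    by (simp add: numeral_2_eq_2 del: L_seq.simps)
  have one: "L_diff H 1 d m t = L_seq H (Suc d) m t - L_seq H d (Suc m) t" for d m t
    by (simp del: L_seq.simps)
  consider "d = 0" | "d = 1" | e where "d = Suc (Suc e)"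
    by (metis One_nat_def not0_implies_Suc)
  then show ?thesis
  proof cases
    case 1
    have R: "L_diff H 2 d m t - (2 * real d + 3) *\<^sub>R L_diff H 1 d m t
        + (2 * real d) *\<^sub>R L_diff H 1 (d - 1) (Suc m) t = H (Suc m) t + t\<^sup>2 *\<^sub>R H (Suc (Suc m)) t" for t
      unfolding two one 1 by (simp add: scaleR_conv_of_real algebra_simps power2_eq_square)
    have L: "L_seq H d m = H m" using 1 by (auto intro!: ext)
    show ?thesis unfolding R L
    proof (rule second_derivative_on_supportI[where V = "\<lambda>t. t *\<^sub>R H (Suc m) t"])
      fix t show "((\<lambda>t. t *\<^sub>R H (Suc m) t) has_vector_derivative H (Suc m) t + t\<^sup>2 *\<^sub>R H (Suc (Suc m)) t) (at t)"
        by (auto intro!: derivative_eq_intros H simp: power2_eq_square)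
    qed (use H in auto)
  next
    case 2
    define G where "G = (\<lambda>t. H (Suc m) t - (t - 1) *\<^sub>R H (Suc (Suc m)) t - H (Suc (Suc m)) t)"
    have R: "L_diff H 2 d m t - (2 * real d + 3) *\<^sub>R L_diff H 1 d m t
        + (2 * real d) *\<^sub>R L_diff H 1 (d - 1) (Suc m) t =
        (t - 1) *\<^sub>R (t *\<^sub>R H (Suc (Suc m)) t - (t - 1) *\<^sub>R (t *\<^sub>R H (Suc (Suc (Suc m))) t) - H (Suc (Suc m)) t
            - t *\<^sub>R H (Suc (Suc (Suc m))) t) + G t" for t
      unfolding two one 2 G_def by (simp add: scaleR_conv_of_real algebra_simps power2_eq_square)
    show ?thesis unfolding R
    proof (rule second_derivative_on_supportI[where V = "\<lambda>t. (t - 1) *\<^sub>R G t"])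
      fix t
      show "(L_seq H d m has_vector_derivative (t - 1) *\<^sub>R G t) (at t)"
        using L_seq_deriv[OF assms, of 0 m t] by (simp add: 2 G_def)
      have "(G has_vector_derivative t *\<^sub>R H (Suc (Suc m)) t - (t - 1) *\<^sub>R (t *\<^sub>R H (Suc (Suc (Suc m))) t)
           - H (Suc (Suc m)) t - t *\<^sub>R H (Suc (Suc (Suc m))) t) (at t)"
        unfolding G_def by (auto intro!: derivative_eq_intros H)
      then show "((\<lambda>t. (t - 1) *\<^sub>R G t) has_vector_derivative 
        (t - 1) *\<^sub>R (t *\<^sub>R H (Suc (Suc m)) t - (t - 1) *\<^sub>R (t *\<^sub>R H (Suc (Suc (Suc m))) t) - H (Suc (Suc m)) t
            - t *\<^sub>R H (Suc (Suc (Suc m))) t) + G t) (at t)"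
        by (auto intro!: derivative_eq_intros)
    qed (auto simp: L_seq_eq_0 G_def)
  next
    case 3
    have R: "L_diff H 2 d m t - (2 * real d + 3) *\<^sub>R L_diff H 1 d m t
        + (2 * real d) *\<^sub>R L_diff H 1 (d - 1) (Suc m) t =
        (t - 1) *\<^sub>R ((t - 1) *\<^sub>R L_diff H 2 e (Suc (Suc m)) t) + L_diff H 1 (Suc e) (Suc m) t" for t
      unfolding two one 3 by (simp add: scaleR_conv_of_real algebra_simps power2_eq_square)
    show ?thesis unfolding R
    proof (rule second_derivative_on_supportI[where V = "\<lambda>t. (t - 1) *\<^sub>R L_diff H 1 (Suc e) (Suc m) t"])
      fix t
      show "(L_seq H d m has_vector_derivative (t - 1) *\<^sub>R L_diff H 1 (Suc e) (Suc m) t) (at t)"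
        using L_seq_deriv[OF assms, of "Suc e" m t] by (simp add: one 3 del: L_seq.simps)
      have "(L_diff H 1 (Suc e) (Suc m) has_vector_derivative (t - 1) *\<^sub>R L_diff H 2 e (Suc (Suc m)) t) (at t)"
        using L_diff_deriv[OF assms, of 1 e "Suc m" t] unfolding numeral_2_eq_2 One_nat_def .
      then show "((\<lambda>t. (t - 1) *\<^sub>R L_diff H 1 (Suc e) (Suc m) t) has_vector_derivative
         (t - 1) *\<^sub>R ((t - 1) *\<^sub>R L_diff H 2 e (Suc (Suc m)) t) + L_diff H 1 (Suc e) (Suc m) t) (at t)"
        by (auto intro!: derivative_eq_intros simp del: L_diff.simps One_nat_def)
    qed (auto simp: L_seq_eq_0 L_diff_eq_0 simp del: L_diff.simps L_seq.simps)
  qed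
qed

text \<open>
  For \<open>d = 0\<close> this is \<open>M\<^sub>j\<^sub>+\<^sub>2 = (2j+3) M\<^sub>j\<^sub>+\<^sub>1 + (d/dt)\<^sup>2 M\<^sub>j\<close>. The terms with \<open>d > 0\<close> are needed for the
  induction on \<open>j\<close>: passing to differences, the coefficient \<open>2(j + d) + 3\<close> jumps by 2, which
  lowers the coefficient \<open>2d + 2\<close> of the last term to \<open>2d\<close>.
\<close>
lemma L_diff_second_derivative:
  assumes "radial_chain H"
  shows "second_derivative_on_support H (L_diff H j d m)
     (\<lambda>t. L_diff H (j + 2) d m t - (2 * real (j + d) + 3) *\<^sub>R L_diff H (Suc j) d m t
        + (2 * real d) *\<^sub>R L_diff H (Suc j) (d - 1) (Suc m) t)"
proof (induction j arbitrary: d m)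
  case 0
  have [simp]: "L_diff H 0 d m = L_seq H d m" by (rule ext) simp
  show ?case using L_seq_second_derivative[OF assms, of d m] by (simp add: numeral_2_eq_2 del: L_seq.simps)
next
  case (Suc j)
  have F: "L_diff H (Suc j) d m = (\<lambda>t. L_diff H j (Suc d) m t - L_diff H j d (Suc m) t)"
    by (rule ext) simp
  have R: "L_diff H (Suc j + 2) d m t - (2 * real (Suc j + d) + 3) *\<^sub>R L_diff H (Suc (Suc j)) d m t
        + (2 * real d) *\<^sub>R L_diff H (Suc (Suc j)) (d - 1) (Suc m) t
     = (L_diff H (j + 2) (Suc d) m t - (2 * real (j + Suc d) + 3) *\<^sub>R L_diff H (Suc j) (Suc d) m t
        + (2 * real (Suc d)) *\<^sub>R L_diff H (Suc j) (Suc d - 1) (Suc m) t)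
     - (L_diff H (j + 2) d (Suc m) t - (2 * real (j + d) + 3) *\<^sub>R L_diff H (Suc j) d (Suc m) t
        + (2 * real d) *\<^sub>R L_diff H (Suc j) (d - 1) (Suc (Suc m)) t)" for t
    by (cases d) (simp_all add: scaleR_conv_of_real algebra_simps)
  show ?case
    unfolding F[of] R by (rule second_derivative_on_support_diff[OF Suc.IH Suc.IH])
qed

text \<open>
  With \<open>f(2 - t) = f(t)\<close>, both \<open>f'\<close> and \<open>t - 1\<close> are odd about 1, so their quotient is even there. At
  \<open>t = 1\<close> itself there is nothing to show.
\<close>
lemma even_about_1_derivative:
  assumes "\<And>t. f (2 - t) = f t"
    and d: "\<And>t. (f has_vector_derivative (t - 1) *\<^sub>R g t) (at t)"
  shows "g (2 - t) = g t"
proof (cases "t = 1")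
  case False
  have "((f \<circ> (\<lambda>t. 2 - t)) has_vector_derivative (-1) *\<^sub>R (((2 - t) - 1) *\<^sub>R g (2 - t))) (at t)"
    by (rule vector_diff_chain_at[OF _ d]) (auto intro!: derivative_eq_intros)
  moreover have "f \<circ> (\<lambda>t. 2 - t) = f" using assms(1) by auto
  ultimately have "(-1) *\<^sub>R (((2 - t) - 1) *\<^sub>R g (2 - t)) = (t - 1) *\<^sub>R g t"
    using vector_derivative_unique_at[OF _ d[of t]] by metis
  then have "(t - 1) *\<^sub>R g (2 - t) = (t - 1) *\<^sub>R g t" by (simp flip: scaleR_minus_left)
  then show ?thesis using False by simp
qed simp

lemma L_diff_even_about_1:
  assumes "radial_chain H" and "\<And>t. L_seq H (j + d) m (2 - t) = L_seq H (j + d) m t"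
  shows "L_diff H j d (m + j) (2 - t) = L_diff H j d (m + j) t"
  using assms(2)
proof (induction j arbitrary: d t)
  case (Suc j)
  have "L_diff H j (Suc d) (m + j) (2 - t) = L_diff H j (Suc d) (m + j) t" for t
    using Suc by simp
  from even_about_1_derivative[OF this L_diff_deriv[OF assms(1)]]
  show ?case by simp
qed simp

section \<open>Radial derivatives of test functions\<close>

lemma D_op_iterate_Suc:
  "(D_op ^^ Suc n) f t = (1 / t) *\<^sub>R vector_derivative ((D_op ^^ n) f) (at t)"
proof -
  have "(D_op ^^ Suc n) f t = D_op ((D_op ^^ n) f) t" by simp
  then show ?thesis by (simp only: D_op_def scaleR_conv_of_real of_real_divide of_real_1)
qed

text \<open>
  The functions that agree on \<open>S\<close> with a combination of the \<open>G n\<close> with coefficients \<open>c / t\<^sup>i\<close>. When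
  \<open>G\<close> lists the successive derivatives of a function, this class is closed under differentiation and
  under \<open>D\<close>, so it yields the smoothness of all \<open>D\<^sup>m h\<close> without an explicit formula for them.
\<close>
inductive radial_span :: "real set \<Rightarrow> (nat \<Rightarrow> real \<Rightarrow> 'a::real_normed_vector) \<Rightarrow> (real \<Rightarrow> 'a) \<Rightarrow> bool"
  for S G where
  base: "radial_span S G (G n)"
| add: "radial_span S G f \<Longrightarrow> radial_span S G g \<Longrightarrow> radial_span S G (\<lambda>t. f t + g t)"
| weight: "radial_span S G f \<Longrightarrow> radial_span S G (\<lambda>t. (c / t) *\<^sub>R f t)"
| cong: "radial_span S G f \<Longrightarrow> (\<And>t. t \<in> S \<Longrightarrow> f t = g t) \<Longrightarrow> radial_span S G g"

lemma radial_span_deriv: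
  assumes "open S" "0 \<notin> S"
    and G: "\<And>n t. t \<in> S \<Longrightarrow> (G n has_vector_derivative G (Suc n) t) (at t)"
    and "radial_span S G f"
  shows "\<exists>f'. radial_span S G f' \<and> (\<forall>t\<in>S. (f has_vector_derivative f' t) (at t))"
  using assms(4)
proof induction
  case (base n)
  then show ?case using G radial_span.base by blast
next
  case (add f g)
  then obtain f' g' where "radial_span S G f'" "\<forall>t\<in>S. (f has_vector_derivative f' t) (at t)"
     "radial_span S G g'" "\<forall>t\<in>S. (g has_vector_derivative g' t) (at t)" by blast
  then show ?case
    by (intro exI[of _ "\<lambda>t. f' t + g' t"]) (auto intro!: radial_span.add has_vector_derivative_add)
next
  case (weight f c)
  then obtain f' where f': "radial_span S G f'" "\<forall>t\<in>S. (f has_vector_derivative f' t) (at t)" by blast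
  have "((\<lambda>t. (c / t) *\<^sub>R f t) has_vector_derivative (c / t) *\<^sub>R f' t + (-c / t) *\<^sub>R ((1 / t) *\<^sub>R f t)) (at t)"
    if "t \<in> S" for t
  proof -
    have "t \<noteq> 0" using that assms(2) by auto
    then have "((\<lambda>t. c / t) has_real_derivative (-c / t) * (1 / t)) (at t)"
      by (auto intro!: derivative_eq_intros)
    from has_vector_derivative_scaleR[OF this f'(2)[rule_format, OF that]] show ?thesis
      by simp
  qed
  moreover have "radial_span S G (\<lambda>t. (c / t) *\<^sub>R f' t + (-c / t) *\<^sub>R ((1 / t) *\<^sub>R f t))"
    by (intro radial_span.add radial_span.weight f' weight.hyps)
  ultimately show ?case by blast
next
  case (cong f g)
  then obtain f' where f': "radial_span S G f'" "\<forall>t\<in>S. (f has_vector_derivative f' t) (at t)" by blast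
  have "(g has_vector_derivative f' t) (at t)" if "t \<in> S" for t
    using has_vector_derivative_transform_within_open[OF f'(2)[rule_format, OF that] \<open>open S\<close> that]
      cong.hyps(2) by blast
  then show ?case using f'(1) by blast
qed

lemma D_op_iterate_radial_span:
  assumes "open S" "0 \<notin> S"
    and G: "\<And>n t. t \<in> S \<Longrightarrow> (G n has_vector_derivative G (Suc n) t) (at t)"
  shows "radial_span S G ((D_op ^^ m) (G 0))"
proof (induction m)
  case (Suc m)
  obtain f' where f': "radial_span S G f'"
     "\<forall>t\<in>S. ((D_op ^^ m) (G 0) has_vector_derivative f' t) (at t)"
    using radial_span_deriv[OF assms Suc] by blast
  have "radial_span S G (\<lambda>t. (1 / t) *\<^sub>R f' t)"
    by (rule radial_span.weight[OF f'(1)])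
  then show ?case
    by (rule radial_span.cong)
       (use f'(2) in \<open>auto simp: D_op_iterate_Suc vector_derivative_at simp del: funpow.simps\<close>)
qed (simp add: radial_span.base)

lemma D_op_iterate_eq_0:
  assumes "open U" "\<And>t. t \<in> U \<Longrightarrow> h t = 0" "t \<in> U"
  shows "(D_op ^^ m) h t = 0"
  using assms(3)
proof (induction m arbitrary: t)
  case (Suc m)
  have "((D_op ^^ m) h has_vector_derivative 0) (at t)"
    by (rule has_vector_derivative_transform_within_open[of "\<lambda>_. 0" _ _ U])
       (use Suc assms(1) in auto)
  then show ?case by (simp add: D_op_iterate_Suc vector_derivative_at del: funpow.simps)
qed (use assms in auto)

text \<open>
  On \<open>S\<close> this is differentiability of the iterates. Off \<open>S\<close> all iterates vanish near \<open>t\<close>, because \<open>h\<close>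
  has closed support inside \<open>S\<close>; this covers \<open>t = 0\<close>.
\<close>
lemma D_op_iterate_deriv:
  fixes h :: "real \<Rightarrow> 'a::{real_normed_field,banach}"
  assumes h: "h \<in> Cc_infinity S" and S: "open S" "0 \<notin> S"
  shows "((D_op ^^ m) h has_vector_derivative t *\<^sub>R (D_op ^^ Suc m) h t) (at t)"
proof (cases "t \<in> S")
  case True
  define G where "G n = ((\<lambda>g s. vector_derivative g (at s)) ^^ n) h" for n
  have G: "(G n has_vector_derivative G (Suc n) t) (at t)" if "t \<in> S" for n t
    using h that by (auto simp: Cc_infinity_def G_def vector_derivative_works)
  have "radial_span S G ((D_op ^^ m) (G 0))"
    by (rule D_op_iterate_radial_span[of S G, OF S G])
  from radial_span_deriv[of S G, OF S G this]
  obtain f' where "((D_op ^^ m) h has_vector_derivative f' t) (at t)"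
    using True by (auto simp: G_def)
  moreover have "t \<noteq> 0" using True S by auto
  ultimately show ?thesis
    by (auto simp: D_op_iterate_Suc vector_derivative_at simp del: funpow.simps)
next
  case False
  define U where "U = - closure {t. h t \<noteq> 0}"
  have U: "open U" "\<And>t. t \<in> U \<Longrightarrow> h t = 0" "t \<in> U"
    using False h closure_subset[of "{t. h t \<noteq> 0}"] by (auto simp: U_def Cc_infinity_def)
  have "((D_op ^^ m) h has_vector_derivative 0) (at t)"
    by (rule has_vector_derivative_transform_within_open[of "\<lambda>_. 0" _ _ U])
       (use U D_op_iterate_eq_0[of U h] in auto)
  then show ?thesis
    using D_op_iterate_eq_0[of U h, OF U, of "Suc m"] by simp
qed

lemma Cc_infinity_Ioo_support:
  assumes "h \<in> Cc_infinity {a<..<b::real}" "a < b"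
  obtains \<epsilon> where "\<epsilon> > 0" "\<epsilon> < (b - a) / 2"
    "\<And>m t. t \<notin> {a + \<epsilon><..<b - \<epsilon>} \<Longrightarrow> (D_op ^^ m) h t = 0"
proof -
  define K where "K = closure {t. h t \<noteq> 0}"
  have K: "compact K" "K \<subseteq> {a<..<b}" using assms by (auto simp: Cc_infinity_def K_def)
  have "closed (- {a<..<b})" "K \<inter> - {a<..<b} = {}" using K by (auto simp: closed_Compl)
  from separate_compact_closed[OF K(1) this]
  obtain d where d: "d > 0" "\<forall>x\<in>K. \<forall>y\<in>- {a<..<b}. d \<le> dist x y" by (elim exE conjE)
  define \<epsilon> where "\<epsilon> = min (d / 2) ((b - a) / 4)"
  have "K \<subseteq> {a + \<epsilon><..<b - \<epsilon>}"
  proof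
    fix x assume "x \<in> K"
    then have "d \<le> dist x a" "d \<le> dist x b" "a < x" "x < b" using d(2) K(2) by auto
    then show "x \<in> {a + \<epsilon><..<b - \<epsilon>}" using d(1) by (auto simp: \<epsilon>_def dist_real_def)
  qed
  moreover have "(D_op ^^ m) h t = 0" if "t \<in> - K" for m t
    by (rule D_op_iterate_eq_0[of "- K"])
       (use that closure_subset[of "{t. h t \<noteq> 0}"] in \<open>auto simp: K_def\<close>)
  ultimately have zero: "(D_op ^^ m) h t = 0" if "t \<notin> {a + \<epsilon><..<b - \<epsilon>}" for m t
    using that by (meson ComplI subsetD)
  have "\<epsilon> > 0" "\<epsilon> < (b - a) / 2"
    using d(1) assms(2) by (auto simp: \<epsilon>_def min_def field_simps)
  then show ?thesis by (rule that) (rule zero)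
qed

section \<open>Bessel functions by their three-term recurrence\<close>

text \<open>
  For \<open>e' = de/dx\<close> and \<open>e'' = -e\<close> this is \<open>((1/x) d/dx)\<^sup>n (e x / x)\<close> on \<open>x > 0\<close>. Taking the recurrence
  \<open>x\<^sup>2 \<phi>\<^sub>n\<^sub>+\<^sub>2 + (2n+3) \<phi>\<^sub>n\<^sub>+\<^sub>1 + \<phi>\<^sub>n = 0\<close> as the definition makes differentiability immediate, and one definition
  serves for both kinds.
\<close>
fun bessel_seq :: "(real \<Rightarrow> real) \<Rightarrow> (real \<Rightarrow> real) \<Rightarrow> nat \<Rightarrow> real \<Rightarrow> real" where
  "bessel_seq e e' 0 x = e x / x"
| "bessel_seq e e' (Suc 0) x = e' x / x ^ 2 - e x / x ^ 3"
| "bessel_seq e e' (Suc (Suc n)) x =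
     - ((2 * real n + 3) * bessel_seq e e' (Suc n) x + bessel_seq e e' n x) / x\<^sup>2"

text \<open>
  The induction step for \<open>\<phi>\<^sub>n' = x \<phi>\<^sub>n\<^sub>+\<^sub>1\<close>: differentiating the recurrence gives the next one, whose
  coefficient \<open>c\<close> grows by 2 from the derivative of \<open>x\<^sup>2\<close>.
\<close>
lemma recurrence_step_deriv:
  fixes P Q :: "real \<Rightarrow> real"
  assumes P: "(P has_real_derivative x * Q x) (at x)"
    and Q: "(Q has_real_derivative x * r) (at x)"
    and r: "r = - (c * Q x + P x) / x\<^sup>2" and "x \<noteq> 0"
  shows "((\<lambda>x. - (c * Q x + P x) / x\<^sup>2) has_real_derivative x * (- ((c + 2) * r + Q x) / x\<^sup>2)) (at x)"
proof -
  have sq: "((\<lambda>x. x\<^sup>2) has_real_derivative 2 * x) (at x)"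
    by (auto intro!: derivative_eq_intros)
  have num: "- (c * Q x + P x) = r * x\<^sup>2" using r \<open>x \<noteq> 0\<close> by simp
  have "((\<lambda>x. - (c * Q x + P x) / x\<^sup>2) has_real_derivative
      (- (c * (x * r) + x * Q x) * x\<^sup>2 - - (c * Q x + P x) * (2 * x)) / (x\<^sup>2 * x\<^sup>2)) (at x)"
    by (rule DERIV_divide[OF DERIV_minus[OF DERIV_add[OF DERIV_cmult[OF Q] P]] sq]) (use \<open>x \<noteq> 0\<close> in simp)
  moreover have "(- (c * (x * r) + x * Q x) * x\<^sup>2 - (r * x\<^sup>2) * (2 * x)) / (x\<^sup>2 * x\<^sup>2)
      = x * (- ((c + 2) * r + Q x) / x\<^sup>2)"
    using \<open>x \<noteq> 0\<close> by (simp add: power2_eq_square divide_simps) (simp add: algebra_simps)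
  ultimately show ?thesis unfolding num by simp
qed

lemma bessel_seq_deriv:
  assumes "\<And>x. (e has_real_derivative e' x) (at x)"
    and "\<And>x. (e' has_real_derivative - e x) (at x)"
    and "x > 0"
  shows "(bessel_seq e e' n has_real_derivative x * bessel_seq e e' (Suc n) x) (at x)"
proof (induction n rule: induct_nat_012)
  case 0
  have F: "bessel_seq e e' 0 = (\<lambda>x. e x / x)" by (rule ext) simp
  show ?case unfolding F using \<open>x > 0\<close>
    by (auto intro!: derivative_eq_intros assms(1,2) simp: field_simps eval_nat_numeral)
next
  case 1
  have F: "bessel_seq e e' (Suc 0) = (\<lambda>x. e' x / x ^ 2 - e x / x ^ 3)" by (rule ext) simp
  show ?case unfolding F using \<open>x > 0\<close>
    by (auto intro!: derivative_eq_intros assms(1,2) simp: field_simps eval_nat_numeral)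
next
  case (ge2 n)
  have F: "bessel_seq e e' (Suc (Suc n)) =
     (\<lambda>x. - ((2 * real n + 3) * bessel_seq e e' (Suc n) x + bessel_seq e e' n x) / x\<^sup>2)"
    by (rule ext) simp
  have c: "2 * real (Suc n) + 3 = (2 * real n + 3) + 2" by simp
  have "x \<noteq> 0" using \<open>x > 0\<close> by simp
  show ?case
    using recurrence_step_deriv[OF ge2 bessel_seq.simps(3) \<open>x \<noteq> 0\<close>]
    unfolding F[symmetric] bessel_seq.simps(3)[of e e' "Suc n"] c .
qed

lemma D_op_iterate_eq_bessel_seq:
  assumes "\<And>x. (e has_real_derivative e' x) (at x)"
    and "\<And>x. (e' has_real_derivative - e x) (at x)"
    and "x > 0"
  shows "(D_op ^^ n) (\<lambda>x. e x / x) x = bessel_seq e e' n x"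
  using \<open>x > 0\<close>
proof (induction n arbitrary: x)
  case (Suc n)
  have "(bessel_seq e e' n has_vector_derivative x * bessel_seq e e' (Suc n) x) (at x)"
    using bessel_seq_deriv[of e e' x n] assms(1,2) Suc.prems
    by (simp add: has_real_derivative_iff_has_vector_derivative)
  then have "((D_op ^^ n) (\<lambda>x. e x / x) has_vector_derivative x * bessel_seq e e' (Suc n) x) (at x)"
    by (rule has_vector_derivative_transform_within_open[of _ _ _ "{0<..}"])
       (use Suc in auto)
  then have "vector_derivative ((D_op ^^ n) (\<lambda>x. e x / x)) (at x) = x * bessel_seq e e' (Suc n) x"
    by (rule vector_derivative_at)
  then show ?case
    using Suc.prems by (simp add: D_op_iterate_Suc del: bessel_seq.simps funpow.simps)
qed simp

text \<open>
  Since \<open>d/dt \<phi>\<^sub>n(\<lambda>t) = \<lambda>\<^sup>2 t \<phi>\<^sub>n\<^sub>+\<^sub>1(\<lambda>t)\<close> and \<open>H m' = t H (m + 1)\<close>, one integration by parts trades an order of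
  the Bessel function for a step along the chain.
\<close>
lemma integral_bessel_parts:
  fixes H :: "nat \<Rightarrow> real \<Rightarrow> 'a::{real_normed_field,banach}"
  assumes H: "radial_chain H" and z: "\<And>m. H m a = 0" "\<And>m. H m b = 0" and "0 < a" "a \<le> b" "lam > 0"
    and e: "\<And>x. (e has_real_derivative e' x) (at x)" "\<And>x. (e' has_real_derivative - e x) (at x)"
  shows "integral {a..b} (\<lambda>t. (t * bessel_seq e e' n (lam * t)) *\<^sub>R H m t)
    = ((-1 / lam\<^sup>2) ^ n / lam) *\<^sub>R integral {a..b} (\<lambda>t. e (lam * t) *\<^sub>R H (m + n) t)"
proof (induction n arbitrary: m)
  case 0
  have "integral {a..b} (\<lambda>t. (t * bessel_seq e e' 0 (lam * t)) *\<^sub>R H m t)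
      = integral {a..b} (\<lambda>t. (1 / lam) *\<^sub>R (e (lam * t) *\<^sub>R H m t))"
    by (intro integral_cong) (use \<open>0 < a\<close> \<open>lam > 0\<close> in auto)
  also have "\<dots> = (1 / lam) *\<^sub>R integral {a..b} (\<lambda>t. e (lam * t) *\<^sub>R H m t)"
    by (rule integral_cmul)
  finally show ?case by simp
next
  case (Suc n)
  let ?\<phi> = "bessel_seq e e'"
  have Hd: "\<And>m t. (H m has_vector_derivative t *\<^sub>R H (Suc m) t) (at t)"
    using H by (simp add: radial_chain_def)
  have cont: "continuous_on {a..b} (H m)" for m
    using Hd by (meson has_vector_derivative_continuous continuous_at_imp_continuous_on)
  have \<phi>: "((\<lambda>t. ?\<phi> n (lam * t)) has_real_derivative lam\<^sup>2 * (t * ?\<phi> (Suc n) (lam * t))) (at t)"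
    if "t \<in> {a..b}" for t n
  proof -
    have "lam * t > 0" using that \<open>0 < a\<close> \<open>lam > 0\<close> by auto
    have "((\<lambda>t. lam * t) has_real_derivative lam) (at t)" by (auto intro!: derivative_eq_intros)
    from DERIV_chain2[where f = "?\<phi> n", OF bessel_seq_deriv[OF e \<open>lam * t > 0\<close>] this]
    show ?thesis by (simp add: power2_eq_square mult_ac del: bessel_seq.simps)
  qed
  have c\<phi>: "continuous_on {a..b} (\<lambda>t. ?\<phi> n (lam * t))"
    using \<phi> by (meson DERIV_isCont continuous_at_imp_continuous_on)
  have "((\<lambda>t. ?\<phi> n (lam * t) *\<^sub>R (t *\<^sub>R H (Suc m) t) + (lam\<^sup>2 * (t * ?\<phi> (Suc n) (lam * t))) *\<^sub>R H m t) has_integral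
      ?\<phi> n (lam * b) *\<^sub>R H m b - ?\<phi> n (lam * a) *\<^sub>R H m a) {a..b}"
    by (intro fundamental_theorem_of_calculus \<open>a \<le> b\<close>
          has_vector_derivative_at_within[OF has_vector_derivative_scaleR[OF \<phi> Hd]])
  then have A: "((\<lambda>t. ?\<phi> n (lam * t) *\<^sub>R (t *\<^sub>R H (Suc m) t) + (lam\<^sup>2 * (t * ?\<phi> (Suc n) (lam * t))) *\<^sub>R H m t) has_integral 0) {a..b}"
    using z by simp
  let ?J = "integral {a..b} (\<lambda>t. (t * ?\<phi> n (lam * t)) *\<^sub>R H (Suc m) t)"
  have B: "((\<lambda>t. (t * ?\<phi> n (lam * t)) *\<^sub>R H (Suc m) t) has_integral ?J) {a..b}"
    by (intro integrable_integral integrable_continuous_interval continuous_intros c\<phi> cont)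
  have "((\<lambda>t. (t * ?\<phi> (Suc n) (lam * t)) *\<^sub>R H m t) has_integral (1 / lam\<^sup>2) *\<^sub>R (0 - ?J)) {a..b}"
    by (rule has_integral_eq[OF _ has_integral_cmul[OF has_integral_diff[OF A B]]])
       (use \<open>lam > 0\<close> in \<open>simp add: mult.commute del: bessel_seq.simps\<close>)
  then have "integral {a..b} (\<lambda>t. (t * ?\<phi> (Suc n) (lam * t)) *\<^sub>R H m t) = (1 / lam\<^sup>2) *\<^sub>R (0 - ?J)"
    by (rule integral_unique)
  then show ?case unfolding Suc.IH by (simp del: bessel_seq.simps)
qed

section \<open>Integration against the shifted sine\<close>

lemma integral_sin_even_eq_0:
  fixes f :: "real \<Rightarrow> 'a::banach"
  assumes "\<And>t. f (2 - t) = f t"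
  shows "integral {a..2 - a} (\<lambda>t. sin (lam * (t - 1)) *\<^sub>R f t) = 0"
proof -
  let ?g = "\<lambda>t. sin (lam * (t - 1)) *\<^sub>R f t"
  have odd: "?g (2 - t) = - ?g t" for t
  proof -
    have "lam * (2 - t - 1) = - (lam * (t - 1))" by (simp add: algebra_simps)
    then show ?thesis using assms[of t] by simp
  qed
  show ?thesis
  proof (cases "?g integrable_on {a..2 - a}")
    case True
    have "(?g has_integral integral {a..2 - a} ?g) (cbox a (2 - a))"
      using True by (simp add: integrable_integral)
    from has_integral_affinity[OF this, of "-1" 2]
    have "((\<lambda>t. - ?g t) has_integral integral {a..2 - a} ?g) ((\<lambda>x. 2 - x) ` {a..2 - a})"
      using odd by (simp add: algebra_simps)
    moreover have "(\<lambda>x. 2 - x) ` {a..2 - a} = {a..2 - a}"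
      by (simp add: image_diff_atLeastAtMost)
    ultimately have "((\<lambda>t. - ?g t) has_integral integral {a..2 - a} ?g) {a..2 - a}" by simp
    from has_integral_unique[OF this has_integral_neg[OF integrable_integral[OF True]]]
    have "integral {a..2 - a} ?g = - integral {a..2 - a} ?g" .
    then have "2 *\<^sub>R integral {a..2 - a} ?g = 0" by (simp only: scaleR_2 eq_neg_iff_add_eq_0)
    then show ?thesis by simp
  qed (simp add: not_integrable_integral)
qed

lemma integral_sin_second_derivative:
  fixes F :: "real \<Rightarrow> 'a::{real_normed_field,banach}"
  assumes "second_derivative_on_support H F F2" "\<And>m. H m a = 0" "\<And>m. H m b = 0" "a \<le> b"
  shows "((\<lambda>t. sin (lam * (t - 1)) *\<^sub>R F2 t) has_integral
     - (lam\<^sup>2 *\<^sub>R integral {a..b} (\<lambda>t. sin (lam * (t - 1)) *\<^sub>R F t))) {a..b}"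
proof -
  obtain V where F: "\<And>t. (F has_vector_derivative V t) (at t)"
     and V: "\<And>t. (V has_vector_derivative F2 t) (at t)"
     and z: "\<And>t. (\<forall>m. H m t = 0) \<Longrightarrow> F t = 0 \<and> V t = 0"
    using assms(1) unfolding second_derivative_on_support_def by blast
  let ?s = "\<lambda>t. sin (lam * (t - 1))" and ?c = "\<lambda>t. cos (lam * (t - 1))"
  have "((\<lambda>t. ?s t *\<^sub>R V t - (lam * ?c t) *\<^sub>R F t) has_vector_derivative
      (?s t *\<^sub>R F2 t + lam\<^sup>2 *\<^sub>R (?s t *\<^sub>R F t))) (at t)" for t
    by (auto intro!: derivative_eq_intros F V)
       (simp add: scaleR_conv_of_real algebra_simps power2_eq_square)
  then have "((\<lambda>t. ?s t *\<^sub>R F2 t + lam\<^sup>2 *\<^sub>R (?s t *\<^sub>R F t)) has_integral 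
     ((?s b *\<^sub>R V b - (lam * ?c b) *\<^sub>R F b) - (?s a *\<^sub>R V a - (lam * ?c a) *\<^sub>R F a))) {a..b}"
    by (intro fundamental_theorem_of_calculus \<open>a \<le> b\<close>) (auto intro: has_vector_derivative_at_within)
  then have A: "((\<lambda>t. ?s t *\<^sub>R F2 t + lam\<^sup>2 *\<^sub>R (?s t *\<^sub>R F t)) has_integral 0) {a..b}"
    using z assms(2,3) by simp
  have "continuous_on {a..b} F"
    using F by (meson has_vector_derivative_continuous continuous_at_imp_continuous_on)
  then have "(\<lambda>t. ?s t *\<^sub>R F t) integrable_on {a..b}"
    by (intro integrable_continuous_interval continuous_intros)
  then have "((\<lambda>t. lam\<^sup>2 *\<^sub>R (?s t *\<^sub>R F t)) has_integral lam\<^sup>2 *\<^sub>R integral {a..b} (\<lambda>t. ?s t *\<^sub>R F t)) {a..b}"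
    by (intro has_integral_cmul integrable_integral)
  from has_integral_diff[OF A this] show ?thesis by simp
qed

text \<open>
  Multiplied by \<open>\<lambda>\<^bsup>2k+1\<^esup>\<close>, the Bessel values satisfy \<open>x\<^sub>k\<^sub>+\<^sub>2 = -(2k+3) x\<^sub>k\<^sub>+\<^sub>1 - \<lambda>\<^sup>2 x\<^sub>k\<close>, and so do the integrals
  \<open>(-1)\<^sup>k \<integral> sin(\<lambda>(t - 1)) M\<^sub>k D\<^sup>m h\<close>, by the formula for the second derivative. For \<open>k = 0\<close> the identity
  is the addition theorem for the sine; for \<open>k = 1\<close> it is the same after integrating by parts
  \<open>M\<^sub>1 D\<^sup>m h = H m - (H m)'\<close>.
\<close>
lemma bessel_pairing:
  fixes H :: "nat \<Rightarrow> real \<Rightarrow> 'a::{real_normed_field,banach}"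
  assumes H: "radial_chain H" and z: "\<And>m. H m a = 0" "\<And>m. H m b = 0" and "a \<le> b" "lam > 0"
  shows "lam ^ (2 * k + 1) *\<^sub>R
      (bessel_seq cos (\<lambda>x. - sin x) k lam *\<^sub>R integral {a..b} (\<lambda>t. sin (lam * t) *\<^sub>R H m t)
       - bessel_seq sin cos k lam *\<^sub>R integral {a..b} (\<lambda>t. cos (lam * t) *\<^sub>R H m t))
    = (-1) ^ k *\<^sub>R integral {a..b} (\<lambda>t. sin (lam * (t - 1)) *\<^sub>R L_diff H k 0 m t)"
proof -
  define S where "S = integral {a..b} (\<lambda>t. sin (lam * t) *\<^sub>R H m t)"
  define C where "C = integral {a..b} (\<lambda>t. cos (lam * t) *\<^sub>R H m t)"
  define I where "I k = integral {a..b} (\<lambda>t. sin (lam * (t - 1)) *\<^sub>R L_diff H k 0 m t)" for k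
  define p where "p k = lam ^ (2 * k + 1) * bessel_seq cos (\<lambda>x. - sin x) k lam" for k
  define q where "q k = lam ^ (2 * k + 1) * bessel_seq sin cos k lam" for k
  have Hd: "\<And>m t. (H m has_vector_derivative t *\<^sub>R H (Suc m) t) (at t)"
    using H by (simp add: radial_chain_def)
  have cont: "continuous_on {a..b} (H m)"
    using Hd by (meson has_vector_derivative_continuous continuous_at_imp_continuous_on)
  have iS: "((\<lambda>t. sin (lam * t) *\<^sub>R H m t) has_integral S) {a..b}"
    unfolding S_def by (intro integrable_integral integrable_continuous_interval continuous_intros cont)
  have iC: "((\<lambda>t. cos (lam * t) *\<^sub>R H m t) has_integral C) {a..b}"
    unfolding C_def by (intro integrable_integral integrable_continuous_interval continuous_intros cont)
  have sh: "((\<lambda>t. sin (lam * (t - 1)) *\<^sub>R H m t) has_integral cos lam *\<^sub>R S - sin lam *\<^sub>R C) {a..b}"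
  proof -
    have "sin (lam * (t - 1)) *\<^sub>R H m t = cos lam *\<^sub>R (sin (lam * t) *\<^sub>R H m t) - sin lam *\<^sub>R (cos (lam * t) *\<^sub>R H m t)" for t
      by (simp add: right_diff_distrib sin_diff algebra_simps)
    then show ?thesis by (simp only:) (intro has_integral_diff has_integral_cmul iS iC)
  qed
  have ch: "((\<lambda>t. cos (lam * (t - 1)) *\<^sub>R H m t) has_integral cos lam *\<^sub>R C + sin lam *\<^sub>R S) {a..b}"
  proof -
    have "cos (lam * (t - 1)) *\<^sub>R H m t = cos lam *\<^sub>R (cos (lam * t) *\<^sub>R H m t) + sin lam *\<^sub>R (sin (lam * t) *\<^sub>R H m t)" for t
      by (simp add: right_diff_distrib cos_diff algebra_simps)
    then show ?thesis by (simp only:) (intro has_integral_add has_integral_cmul iS iC)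
  qed
  have "p k *\<^sub>R S - q k *\<^sub>R C = (-1) ^ k *\<^sub>R I k"
  proof (induction k rule: induct_nat_012)
    case 0
    have "I 0 = cos lam *\<^sub>R S - sin lam *\<^sub>R C"
      unfolding I_def using sh by (simp add: integral_unique)
    then show ?case using \<open>lam > 0\<close> by (simp add: p_def q_def)
  next
    case 1
    have "((\<lambda>t. sin (lam * (t - 1)) *\<^sub>R H m t) has_vector_derivative
        sin (lam * (t - 1)) *\<^sub>R (t *\<^sub>R H (Suc m) t) + lam *\<^sub>R (cos (lam * (t - 1)) *\<^sub>R H m t)) (at t)" for t
      by (auto intro!: derivative_eq_intros Hd simp: mult.commute)
    then have "((\<lambda>t. sin (lam * (t - 1)) *\<^sub>R (t *\<^sub>R H (Suc m) t) + lam *\<^sub>R (cos (lam * (t - 1)) *\<^sub>R H m t)) has_integral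
        sin (lam * (b - 1)) *\<^sub>R H m b - sin (lam * (a - 1)) *\<^sub>R H m a) {a..b}"
      by (intro fundamental_theorem_of_calculus \<open>a \<le> b\<close>) (auto intro: has_vector_derivative_at_within)
    then have A: "((\<lambda>t. sin (lam * (t - 1)) *\<^sub>R (t *\<^sub>R H (Suc m) t) + lam *\<^sub>R (cos (lam * (t - 1)) *\<^sub>R H m t)) has_integral 0) {a..b}"
      using z by simp
    have "((\<lambda>t. sin (lam * (t - 1)) *\<^sub>R L_diff H 1 0 m t) has_integral
        (cos lam *\<^sub>R S - sin lam *\<^sub>R C) - 0 + lam *\<^sub>R (cos lam *\<^sub>R C + sin lam *\<^sub>R S)) {a..b}"
      by (rule has_integral_eq[OF _ has_integral_add[OF has_integral_diff[OF sh A] has_integral_cmul[OF ch]]])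
         (simp add: scaleR_conv_of_real algebra_simps)
    then have I1: "I 1 = (cos lam *\<^sub>R S - sin lam *\<^sub>R C) + lam *\<^sub>R (cos lam *\<^sub>R C + sin lam *\<^sub>R S)"
      unfolding I_def by (simp only: integral_unique diff_0_right)
    have pq: "p 1 = - lam * sin lam - cos lam" "q 1 = lam * cos lam - sin lam"
      using \<open>lam > 0\<close> by (simp_all add: p_def q_def field_simps eval_nat_numeral)
    show ?case
      unfolding One_nat_def[symmetric] I1 pq by (simp add: scaleR_conv_of_real algebra_simps)
  next
    case (ge2 k)
    have rec: "lam ^ (2 * Suc (Suc k) + 1) * (- ((2 * real k + 3) * y + x) / lam\<^sup>2)
        = - (2 * real k + 3) * (lam ^ (2 * Suc k + 1) * y) - lam\<^sup>2 * (lam ^ (2 * k + 1) * x)" for x y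
      using \<open>lam > 0\<close> by (simp add: field_simps eval_nat_numeral)
    have pr: "p (Suc (Suc k)) = - (2 * real k + 3) * p (Suc k) - lam\<^sup>2 * p k"
      unfolding p_def bessel_seq.simps(3) by (rule rec)
    have qr: "q (Suc (Suc k)) = - (2 * real k + 3) * q (Suc k) - lam\<^sup>2 * q k"
      unfolding q_def bessel_seq.simps(3) by (rule rec)
    have sd: "second_derivative_on_support H (L_diff H k 0 m)
        (\<lambda>t. L_diff H (k + 2) 0 m t - (2 * real k + 3) *\<^sub>R L_diff H (Suc k) 0 m t)"
      using L_diff_second_derivative[OF H, of k 0 m] by (simp del: L_diff.simps)
    have A: "((\<lambda>t. sin (lam * (t - 1)) *\<^sub>R (L_diff H (k + 2) 0 m t - (2 * real k + 3) *\<^sub>R L_diff H (Suc k) 0 m t))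
        has_integral - (lam\<^sup>2 *\<^sub>R I k)) {a..b}"
      unfolding I_def by (rule integral_sin_second_derivative[OF sd z \<open>a \<le> b\<close>])
    have c: "continuous_on {a..b} (L_diff H (Suc k) 0 m)"
      by (rule second_derivative_on_support_continuous[OF L_diff_second_derivative[OF H]])
    have B: "((\<lambda>t. sin (lam * (t - 1)) *\<^sub>R L_diff H (Suc k) 0 m t) has_integral I (Suc k)) {a..b}"
      unfolding I_def by (intro integrable_integral integrable_continuous_interval continuous_intros c)
    have "((\<lambda>t. sin (lam * (t - 1)) *\<^sub>R L_diff H (Suc (Suc k)) 0 m t) has_integral
        - (lam\<^sup>2 *\<^sub>R I k) + (2 * real k + 3) *\<^sub>R I (Suc k)) {a..b}"
      by (rule has_integral_eq[OF _ has_integral_add[OF A has_integral_cmul[OF B]]])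
         (simp add: scaleR_conv_of_real algebra_simps del: L_diff.simps)
    then have Ik: "I (Suc (Suc k)) = - (lam\<^sup>2 *\<^sub>R I k) + (2 * real k + 3) *\<^sub>R I (Suc k)"
      unfolding I_def[of "Suc (Suc k)"] by (rule integral_unique)
    have "p (Suc (Suc k)) *\<^sub>R S - q (Suc (Suc k)) *\<^sub>R C =
       - (2 * real k + 3) *\<^sub>R (p (Suc k) *\<^sub>R S - q (Suc k) *\<^sub>R C) - lam\<^sup>2 *\<^sub>R (p k *\<^sub>R S - q k *\<^sub>R C)"
      unfolding pr qr by (simp add: scaleR_conv_of_real algebra_simps)
    also have "\<dots> = (-1) ^ Suc (Suc k) *\<^sub>R I (Suc (Suc k))"
      unfolding ge2.IH Ik by (simp add: scaleR_conv_of_real algebra_simps)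
    finally show ?case .
  qed
  then show ?thesis
    by (simp add: S_def C_def I_def p_def q_def scaleR_diff_right)
qed

theorem theorem1p8:
  fixes k :: nat and h :: "real \<Rightarrow> 'a::{real_normed_field,banach}" and lam :: real
  assumes "h \<in> Cc_infinity {0<..<2}"
    and "\<forall>t\<in>{0..1}. L_op k h (1 - t) = L_op k h (1 + t)"
    and "lam > 0"
  shows "integral {0..} (\<lambda>t. of_real (bessel_j k (lam * t) * t) * h t) * of_real (bessel_y k lam)
       = integral {0..} (\<lambda>t. of_real (bessel_y k (lam * t) * t) * h t) * of_real (bessel_j k lam)"
proof -
  \<comment> \<open>Integrating over \<open>{\<epsilon>..2 - \<epsilon>}\<close> avoids the singularity of \<open>y\<^sub>k\<close> at 0 and is symmetric about 1.\<close>
  define H where "H m = (D_op ^^ m) h" for m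
  obtain \<epsilon> where \<epsilon>: "\<epsilon> > 0" "\<epsilon> < 1" and supp: "\<And>m t. t \<notin> {\<epsilon><..<2 - \<epsilon>} \<Longrightarrow> H m t = 0"
    using Cc_infinity_Ioo_support[OF assms(1)] unfolding H_def by auto
  have chain: "radial_chain H"
    using D_op_iterate_deriv[OF assms(1)] by (simp add: radial_chain_def H_def)
  have z: "\<And>m. H m \<epsilon> = 0" "\<And>m. H m (2 - \<epsilon>) = 0" and le: "\<epsilon> \<le> 2 - \<epsilon>"
    using supp \<epsilon> by auto
  define S where "S = integral {\<epsilon>..2 - \<epsilon>} (\<lambda>t. sin (lam * t) *\<^sub>R H k t)"
  define C where "C = integral {\<epsilon>..2 - \<epsilon>} (\<lambda>t. cos (lam * t) *\<^sub>R H k t)"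
  define c where "c = - ((-2) ^ (k + 1) * Gamma (real k + 3/2) / sqrt pi)"
  let ?s = "bessel_seq sin cos k" and ?c = "bessel_seq cos (\<lambda>x. - sin x) k"

  have L_even: "L_seq H k 0 (2 - t) = L_seq H k 0 t" for t
  proof -
    have L: "L_seq H k 0 = L_op k h" unfolding H_def by (intro ext) (simp add: L_op_eq_L_seq)
    consider "t \<in> {0..1}" | "t \<in> {1..2}" | "t \<notin> {0..2}" by force
    then show ?thesis
    proof cases
      case 1
      then show ?thesis using assms(2)[rule_format, of "1 - t"] by (simp add: L)
    next
      case 2
      then show ?thesis using assms(2)[rule_format, of "t - 1"] by (simp add: L)
    next
      case 3
      then have "\<forall>m. H m t = 0" "\<forall>m. H m (2 - t) = 0" using supp \<epsilon> by auto
      then show ?thesis by (simp add: L_seq_eq_0)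
    qed
  qed
  have "L_diff H k 0 k (2 - t) = L_diff H k 0 k t" for t
    using L_diff_even_about_1[OF chain, of k 0 0] L_even by simp
  then have "integral {\<epsilon>..2 - \<epsilon>} (\<lambda>t. sin (lam * (t - 1)) *\<^sub>R L_diff H k 0 k t) = 0"
    by (rule integral_sin_even_eq_0)
  then have balance: "?c lam *\<^sub>R S = ?s lam *\<^sub>R C"
    using bessel_pairing[OF chain z le assms(3), of k k] assms(3) by (simp add: S_def C_def)

  have int: "integral {0..} (\<lambda>t. of_real (B (lam * t) * t) * h t)
      = (c * ((-1 / lam\<^sup>2) ^ k / lam)) *\<^sub>R integral {\<epsilon>..2 - \<epsilon>} (\<lambda>t. e (lam * t) *\<^sub>R H k t)"
    if e: "\<And>x. (e has_real_derivative e' x) (at x)" "\<And>x. (e' has_real_derivative - e x) (at x)"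
      and B: "\<And>x. x > 0 \<Longrightarrow> B x = c * bessel_seq e e' k x" for B e e'
  proof -
    have "integral {0..} (\<lambda>t. of_real (B (lam * t) * t) * h t)
        = integral {\<epsilon>..2 - \<epsilon>} (\<lambda>t. of_real (B (lam * t) * t) * h t)"
      by (rule integral_spike_set)
         (use supp[of _ 0] \<epsilon> in \<open>auto simp: H_def intro!: negligible_subset[OF negligible_empty]\<close>)
    also have "\<dots> = integral {\<epsilon>..2 - \<epsilon>} (\<lambda>t. c *\<^sub>R ((t * bessel_seq e e' k (lam * t)) *\<^sub>R H 0 t))"
      by (intro integral_cong) (use \<epsilon> assms(3) B in \<open>simp add: H_def scaleR_conv_of_real\<close>)
    also have "\<dots> = c *\<^sub>R integral {\<epsilon>..2 - \<epsilon>} (\<lambda>t. (t * bessel_seq e e' k (lam * t)) *\<^sub>R H 0 t)"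
      by (rule integral_cmul)
    finally show ?thesis
      unfolding integral_bessel_parts[OF chain z \<epsilon>(1) le assms(3) e] by simp
  qed
  have sin': "(sin has_real_derivative cos x) (at x)"
      "((\<lambda>x. - sin x) has_real_derivative - cos x) (at x)" for x :: real
    by (auto intro!: derivative_eq_intros)
  have j: "bessel_j k x = c * ?s x" and y: "bessel_y k x = c * ?c x" if "x > 0" for x
    using D_op_iterate_eq_bessel_seq[OF sin'(1) DERIV_cos that, of k]
      D_op_iterate_eq_bessel_seq[OF DERIV_cos sin'(2) that, of k]
    by (simp_all add: bessel_j_def bessel_y_def c_def)
  have "integral {0..} (\<lambda>t. of_real (bessel_j k (lam * t) * t) * h t) = (c * ((-1 / lam\<^sup>2) ^ k / lam)) *\<^sub>R S"
    unfolding S_def by (rule int[OF sin'(1) DERIV_cos j])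
  moreover have "integral {0..} (\<lambda>t. of_real (bessel_y k (lam * t) * t) * h t) = (c * ((-1 / lam\<^sup>2) ^ k / lam)) *\<^sub>R C"
    unfolding C_def by (rule int[OF DERIV_cos sin'(2) y])
  moreover have "(K *\<^sub>R S) * of_real (c * ?c lam) = (K * c) *\<^sub>R (?c lam *\<^sub>R S)"
    and "(K *\<^sub>R C) * of_real (c * ?s lam) = (K * c) *\<^sub>R (?s lam *\<^sub>R C)" for K
    by (simp_all add: scaleR_conv_of_real mult_ac)
  ultimately show ?thesis
    by (simp only: balance j[OF assms(3)] y[OF assms(3)])
qed

end
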